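(* There exist $m_0\in\mathbb Z^+$ and $C_1,C_2>0$ such that, if $$k=2\pi m\sqrt2$$ with $m$ an integer, $m\ge m_0$, then there exist $y\in\mathbb C$ with $$C_1\le k|y|\le C_2$$ and a non-zero $u\in H^1_{\rm loc}([0,\infty))$ such that $$P u=0\ \text{ on }\mathbb R^+,\qquad u(0)=0,\qquad u(x)=\mathrm e^{\mathrm i kx}\ \text{ for } x\ge2 .$$
   Context: For $k>0$ and $y\in\mathbb C$, $P=P(k,y)$ is the one-dimensional Helmholtz operator on $\mathbb R^+=(0,\infty)$ $$P:=k^{-2}\partial_x^2+\Big(1-\big(\tfrac12+y\big)\mathbf 1_{[0,1]}(x)\Big),$$ i.e. $Pu=(k^{-2}\partial_x^2+1)u$ for $x>1$ and $Pu=(k^{-2}\partial_x^2+(\tfrac12-y))u$ for $0<x\le1$. The equation $Pu=0$ is understood in the weak sense. *)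

theory Defs
  imports "HOL-Analysis.Analysis"
begin

(* Functions on the half-line (0,\<infinity>) or [0,\<infinity>) are modelled as functions of type
   real \<Rightarrow> complex; their values outside the half-line are never used. *)

definition smooth :: "(real \<Rightarrow> complex) \<Rightarrow> bool" where
  "smooth \<phi> \<longleftrightarrow>
     (\<forall>n x. ((\<lambda>f t. vector_derivative f (at t)) ^^ n) \<phi> differentiable (at x))"

(* The space of test functions C_c^infinity((0,\<infinity>)): the support keeps away from 0. *)
definition test_functions :: "(real \<Rightarrow> complex) set" where
  "test_functions = {\<phi>. smooth \<phi> \<and> (\<exists>a b. 0 < a \<and> (\<forall>x. x \<notin> {a..b} \<longrightarrow> \<phi> x = 0))}"

(* L^2_loc([0,\<infinity>)), with integrability up to the endpoint 0. *)
definition L2_loc :: "(real \<Rightarrow> complex) set" where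
  "L2_loc = {u. \<forall>R>0. set_borel_measurable lebesgue {0<..<R} u
                    \<and> set_integrable lebesgue {0<..<R} (\<lambda>x. (cmod (u x))\<^sup>2)}"

definition has_weak_derivative :: "(real \<Rightarrow> complex) \<Rightarrow> (real \<Rightarrow> complex) \<Rightarrow> bool" where
  "has_weak_derivative u v \<longleftrightarrow>
     (\<forall>\<phi>\<in>test_functions.
        (LINT x:{0<..}|lebesgue. u x * vector_derivative \<phi> (at x))
          = - (LINT x:{0<..}|lebesgue. v x * \<phi> x))"

(* Membership is invariant under changes of u on null sets; in particular it does not by itself
   select the continuous representative. *)
definition H1_loc :: "(real \<Rightarrow> complex) set" where
  "H1_loc = {u \<in> L2_loc. \<exists>v\<in>L2_loc. has_weak_derivative u v}"

definition helmholtz_coeff :: "complex \<Rightarrow> real \<Rightarrow> complex" where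
  "helmholtz_coeff y x = 1 - (1/2 + y) * indicator {0..1} x"

lemma helmholtz_coeff_gt_1: "x > 1 \<Longrightarrow> helmholtz_coeff y x = 1"
  by (simp add: helmholtz_coeff_def)

lemma helmholtz_coeff_le_1: "0 < x \<Longrightarrow> x \<le> 1 \<Longrightarrow> helmholtz_coeff y x = 1/2 - y"
  by (simp add: helmholtz_coeff_def)

(* P u = k^(-2) u'' + helmholtz_coeff y * u = 0 on (0,\<infinity>) in the weak sense: tested against phi,
   with one derivative moved onto phi. The weak derivative v of u is unique up to null sets. *)
definition helmholtz_weak_solution :: "real \<Rightarrow> complex \<Rightarrow> (real \<Rightarrow> complex) \<Rightarrow> bool" where
  "helmholtz_weak_solution k y u \<longleftrightarrow>
     (\<exists>v\<in>L2_loc. has_weak_derivative u v \<and>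
        (\<forall>\<phi>\<in>test_functions.
           (LINT x:{0<..}|lebesgue.
              - (1 / (of_real k)\<^sup>2) * v x * vector_derivative \<phi> (at x)
              + helmholtz_coeff y x * u x * \<phi> x) = 0))"

end

theory Submission
  imports Defs
begin

text \<open>Write \<open>t\<close> for a square root of \<open>1/2 - y\<close>. Gluing \<open>A sin (k t x)\<close> on \<open>[0,1]\<close> to \<open>e\<^sup>i\<^sup>k\<^sup>x\<close>
  on \<open>[1,\<infinity>)\<close> gives a \<open>C\<^sup>1\<close> function, and hence a weak solution, as soon as
  \<open>t cos (k t) = \<i> sin (k t)\<close>. Since \<open>k / sqrt 2 = 2 \<pi> m\<close>, the substitution
  \<open>t = 1 / sqrt 2 - \<i> \<tau> / k\<close> removes the oscillation and turns this into \<open>tanh \<tau> = t\<close>, a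
  perturbation of \<open>tanh \<tau> = 1 / sqrt 2\<close> of size \<open>1/k\<close>. It has a solution \<open>\<tau>\<close> of size
  comparable to 1 by Brouwer's theorem, and then \<open>k y = \<i> sqrt 2 \<tau> + \<tau>\<^sup>2 / k\<close>.\<close>

section \<open>Test functions, integration by parts and weak derivatives\<close>

text \<open>Passing from a closed support interval to a larger open one makes \<open>\<phi>\<close>
  vanish at the endpoints too, which later kills the boundary terms.\<close>

lemma test_functionE:
  assumes "\<phi> \<in> test_functions"
  obtains a b where "0 < a" "a < b" "\<And>x. x \<notin> {a<..<b} \<Longrightarrow> \<phi> x = 0"
    "\<And>x. x \<notin> {a<..<b} \<Longrightarrow> vector_derivative \<phi> (at x) = 0"
    "\<And>x. (\<phi> has_vector_derivative vector_derivative \<phi> (at x)) (at x)"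
    "continuous_on UNIV (\<lambda>x. vector_derivative \<phi> (at x))"
proof -
  from assms obtain a b where sm: "smooth \<phi>" and a: "0 < a"
    and supp: "\<And>x. x \<notin> {a..b} \<Longrightarrow> \<phi> x = 0"
    by (auto simp: test_functions_def)
  define D where "D = (\<lambda>x. vector_derivative \<phi> (at x))"
  have "\<phi> differentiable (at x)" for x
    using sm[unfolded smooth_def, rule_format, of 0 x] by simp
  hence der: "(\<phi> has_vector_derivative D x) (at x)" for x
    by (simp add: D_def vector_derivative_works)
  have "D differentiable (at x)" for x
    using sm[unfolded smooth_def, rule_format, of 1 x] by (simp add: D_def)
  hence contD: "continuous_on UNIV D"
    by (meson continuous_at_imp_continuous_on differentiable_imp_continuous_within)
  have D0: "D x = 0" if "x \<notin> {a..b}" for x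
  proof -
    have "(\<phi> has_vector_derivative 0) (at x)"
      by (rule has_vector_derivative_transform_within_open[where S = "- {a..b}" and f = "\<lambda>_. 0"])
        (use that supp in \<open>auto intro: open_Compl\<close>)
    thus ?thesis using der vector_derivative_at unfolding D_def by blast
  qed
  show ?thesis
  \<comment> \<open>The definition of \<open>test_functions\<close> allows \<open>b < a\<close>,
    where \<open>\<phi>\<close> is zero; \<open>max\<close> keeps the new interval non-degenerate in
    that case.\<close>
  proof (rule that[of "a/2" "max a b + 1"])
    fix x assume "x \<notin> {a/2<..<max a b + 1}"
    hence "x \<notin> {a..b}" using a by auto
    thus "\<phi> x = 0" "vector_derivative \<phi> (at x) = 0"
      using supp D0 by (auto simp: D_def)
  qed (use a der contD in \<open>auto simp: D_def\<close>)
qed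

text \<open>The fundamental theorem of calculus holds for a continuous function that is
  differentiable off a finite set. The set \<open>S\<close> admits a derivative \<open>g\<close>
  that jumps, as the second derivative of the solution does at 1. Integrability of \<open>g\<close>
  away from 0 suffices because test functions vanish near 0.\<close>

lemma integration_by_parts_test_function:
  fixes f g \<phi> :: "real \<Rightarrow> complex"
  assumes phi: "\<phi> \<in> test_functions"
    and "finite S" and contf: "continuous_on {0<..} f"
    and derf: "\<And>x. 0 < x \<Longrightarrow> x \<notin> S \<Longrightarrow> (f has_vector_derivative g x) (at x)"
    and intg: "\<And>a b. 0 < a \<Longrightarrow> set_integrable lebesgue {a..b} g"
  shows "set_integrable lebesgue {0<..} (\<lambda>x. f x * vector_derivative \<phi> (at x))"
    and "set_integrable lebesgue {0<..} (\<lambda>x. g x * \<phi> x)"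
    and "(LINT x:{0<..}|lebesgue. f x * vector_derivative \<phi> (at x))
       = - (LINT x:{0<..}|lebesgue. g x * \<phi> x)"
proof -
  from phi obtain a b where a: "0 < a" "a < b" and supp: "\<And>x. x \<notin> {a<..<b} \<Longrightarrow> \<phi> x = 0"
    and supp': "\<And>x. x \<notin> {a<..<b} \<Longrightarrow> vector_derivative \<phi> (at x) = 0"
    and der: "\<And>x. (\<phi> has_vector_derivative vector_derivative \<phi> (at x)) (at x)"
    and contD: "continuous_on UNIV (\<lambda>x. vector_derivative \<phi> (at x))"
    by (rule test_functionE) blast
  define D where "D = (\<lambda>x. vector_derivative \<phi> (at x))"
  have cphi: "continuous_on T \<phi>" for T
    using der by (meson continuous_at_imp_continuous_on has_vector_derivative_continuous)
  have contf': "continuous_on {a..b} f"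
    using contf by (rule continuous_on_subset) (use a in auto)
  have contD': "continuous_on {a..b} D"
    using contD unfolding D_def by (rule continuous_on_subset) auto
  \<comment> \<open>Every integrand contains \<open>\<phi>\<close> or its derivative, so integrals
    over the half-line are integrals over the compact interval \<open>{a..b}\<close>.\<close>
  have restrict: "(\<lambda>x. indicator {0<..} x *\<^sub>R h x) = (\<lambda>x. indicator {a..b} x *\<^sub>R h x)"
    if "\<And>x. x \<notin> {a<..<b} \<Longrightarrow> h x = 0" for h :: "real \<Rightarrow> complex"
  proof
    fix x show "indicator {0<..} x *\<^sub>R h x = indicator {a..b} x *\<^sub>R h x"
      using that[of x] a by (cases "x \<in> {a<..<b}") (auto simp: indicator_def)
  qed
  have I1: "set_integrable lebesgue {a..b} (\<lambda>x. f x * D x)"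
    by (intro absolutely_integrable_continuous_real continuous_intros contf' contD')
  \<comment> \<open>Since \<open>g\<close> may be discontinuous, integrability of the product comes
    from \<open>g\<close> being integrable and \<open>\<phi>\<close> being bounded and
    measurable.\<close>
  have "compact (\<phi> ` {a..b})"
    by (intro compact_continuous_image cphi) auto
  hence I2: "set_integrable lebesgue {a..b} (\<lambda>x. \<phi> x * g x)"
    using bilinear_conv_bounded_bilinear bounded_bilinear_mult
    by (intro absolutely_integrable_bounded_measurable_product[where h = "(*)"] intg a
        continuous_imp_measurable_on_sets_lebesgue cphi compact_imp_bounded) auto
  hence I2: "set_integrable lebesgue {a..b} (\<lambda>x. g x * \<phi> x)"
    by (simp add: mult.commute)
  have "((\<lambda>x. f x * D x + g x * \<phi> x) has_integral (f b * \<phi> b - f a * \<phi> a)) {a..b}"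
  proof (rule fundamental_theorem_of_calculus_strong[OF \<open>finite S\<close>])
    show "continuous_on {a..b} (\<lambda>x. f x * \<phi> x)"
      by (intro continuous_intros contf' cphi)
    fix x assume "x \<in> {a..b} - S"
    hence "(f has_vector_derivative g x) (at x)" using derf a by auto
    from has_vector_derivative_mult[OF this der[of x]]
    have "((\<lambda>x. f x * \<phi> x) has_vector_derivative f x * D x + g x * \<phi> x) (at x)"
      by (simp add: D_def)
    thus "((\<lambda>x. f x * \<phi> x) has_vector_derivative f x * D x + g x * \<phi> x) (at x)" .
  qed (use a in auto)
  moreover have "\<phi> a = 0" "\<phi> b = 0" using supp a by auto
  ultimately have "integral {a..b} (\<lambda>x. f x * D x + g x * \<phi> x) = 0"
    by (simp add: integral_unique)
  hence "(LINT x:{a..b}|lebesgue. f x * D x + g x * \<phi> x) = 0"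
    using set_lebesgue_integral_eq_integral(2)[OF set_integral_add(1)[OF I1 I2]] by simp
  hence sum0: "(LINT x:{a..b}|lebesgue. f x * D x) = - (LINT x:{a..b}|lebesgue. g x * \<phi> x)"
    by (simp add: set_integral_add(2)[OF I1 I2] eq_neg_iff_add_eq_0)
  have R1: "(\<lambda>x. indicator {0<..} x *\<^sub>R (f x * D x)) = (\<lambda>x. indicator {a..b} x *\<^sub>R (f x * D x))"
    by (rule restrict) (simp add: supp' D_def)
  have R2: "(\<lambda>x. indicator {0<..} x *\<^sub>R (g x * \<phi> x)) = (\<lambda>x. indicator {a..b} x *\<^sub>R (g x * \<phi> x))"
    by (rule restrict) (simp add: supp)
  show "set_integrable lebesgue {0<..} (\<lambda>x. f x * vector_derivative \<phi> (at x))"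
    using I1 R1 by (simp add: set_integrable_def D_def)
  show "set_integrable lebesgue {0<..} (\<lambda>x. g x * \<phi> x)"
    using I2 R2 by (simp add: set_integrable_def)
  show "(LINT x:{0<..}|lebesgue. f x * vector_derivative \<phi> (at x))
       = - (LINT x:{0<..}|lebesgue. g x * \<phi> x)"
    using sum0 R1 R2 by (simp add: set_lebesgue_integral_def D_def)
qed

lemma continuous_in_L2_loc:
  assumes "continuous_on UNIV u"
  shows "u \<in> L2_loc"
proof -
  have "set_borel_measurable lebesgue {0<..<R} u" for R
    using assms borel_measurable_continuous_onI[OF assms]
    unfolding set_borel_measurable_def
    by (intro borel_measurable_scaleR borel_measurable_indicator measurable_completion) auto
  moreover have "set_integrable lebesgue {0<..<R} (\<lambda>x. (cmod (u x))\<^sup>2)" for R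
    by (rule set_integrable_subset[of _ "{0..R}"])
      (auto intro!: absolutely_integrable_continuous_real continuous_intros
         continuous_on_subset[OF assms])
  ultimately show ?thesis by (simp add: L2_loc_def)
qed

lemma has_weak_derivative_classical:
  assumes "continuous_on UNIV v" "\<And>x. (u has_vector_derivative v x) (at x)"
  shows "has_weak_derivative u v"
  unfolding has_weak_derivative_def
proof
  fix \<phi> assume "\<phi> \<in> test_functions"
  thus "(LINT x:{0<..}|lebesgue. u x * vector_derivative \<phi> (at x)) = - (LINT x:{0<..}|lebesgue. v x * \<phi> x)"
  proof (rule integration_by_parts_test_function(3)[where S = "{}"])
    show "continuous_on {0<..} u"
      using assms(2) by (meson continuous_at_imp_continuous_on has_vector_derivative_continuous)
  qed (use assms in \<open>auto intro!: absolutely_integrable_continuous_real intro: continuous_on_subset\<close>)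
qed

section \<open>Gluing the interior sine to the outgoing wave\<close>

text \<open>The closed half-lines on either side of \<open>c\<close> cover the line and meet only at
  \<open>c\<close>, where both values and derivatives agree.\<close>

lemma has_vector_derivative_glue:
  fixes f g :: "real \<Rightarrow> 'a::real_normed_vector"
  assumes f: "\<And>x. x \<le> c \<Longrightarrow> (f has_vector_derivative f' x) (at x)"
    and g: "\<And>x. c \<le> x \<Longrightarrow> (g has_vector_derivative g' x) (at x)"
    and "f c = g c" "f' c = g' c"
  shows "((\<lambda>x. if x \<le> c then f x else g x) has_vector_derivative (if x \<le> c then f' x else g' x)) (at x)"
proof -
  have "((\<lambda>x. if x \<in> {..c} then f x else g x) has_vector_derivative
      (if x \<in> {..c} then f' x else g' x)) (at x within UNIV)"
  proof (rule has_vector_derivative_If_within_closures[where T = "{c..}"])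
    show "(f has_vector_derivative f' x) (at x within {..c} \<union> closure {..c} \<inter> closure {c..})"
      if "x \<in> {..c} \<union> closure {..c} \<inter> closure {c..}"
      using f[of x] that by (auto intro: has_vector_derivative_at_within)
    show "(g has_vector_derivative g' x) (at x within {c..} \<union> closure {..c} \<inter> closure {c..})"
      if "x \<in> {c..} \<union> closure {..c} \<inter> closure {c..}"
      using g[of x] that by (auto intro: has_vector_derivative_at_within)
    show "f x = g x" "f' x = g' x" if "x \<in> closure {..c}" "x \<in> closure {c..}"
      using that assms by auto
  qed auto
  thus ?thesis by simp
qed

text \<open>The two equations in \<open>match\<close> equate values and first derivatives at 1, so
  \<open>u\<close> is continuously differentiable. Its derivative is continuous and satisfies the
  equation classically off 1, so integration by parts gives the weak form with no contribution from
  the interface.\<close>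

lemma outgoing_solution:
  fixes k :: real and \<kappa> A y :: complex
  defines "u \<equiv> (\<lambda>x. if x \<le> 1 then A * sin (\<kappa> * of_real x) else exp (\<i> * of_real k * of_real x))"
  assumes "0 < k"
    and match: "A * sin \<kappa> = exp (\<i> * k)" "A * \<kappa> * cos \<kappa> = \<i> * k * exp (\<i> * k)"
    and kappa: "\<kappa>\<^sup>2 = k\<^sup>2 * (1/2 - y)"
  shows "u \<in> H1_loc" "continuous_on UNIV u" "helmholtz_weak_solution k y u"
proof -
  define v where "v = (\<lambda>x. if x \<le> 1 then A * \<kappa> * cos (\<kappa> * of_real x)
      else \<i> * of_real k * exp (\<i> * of_real k * of_real x))"
  have du: "(u has_vector_derivative v x) (at x)" for x
    unfolding u_def v_def
    by (rule has_vector_derivative_glue)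
      (use match in \<open>auto intro!: derivative_eq_intros has_vector_derivative_real_field\<close>)
  hence contu: "continuous_on T u" for T
    by (meson continuous_at_imp_continuous_on has_vector_derivative_continuous)
  have contv: "continuous_on UNIV v"
  proof -
    have "continuous_on ({..1} \<union> {1..}) v"
      unfolding v_def by (rule continuous_on_If) (use match in \<open>auto intro!: continuous_intros\<close>)
    moreover have "{..1} \<union> {1..} = (UNIV::real set)" by auto
    ultimately show ?thesis by simp
  qed
  have weak: "has_weak_derivative u v"
    using contv du by (rule has_weak_derivative_classical)
  have L2: "u \<in> L2_loc" "v \<in> L2_loc"
    using contu contv by (auto intro: continuous_in_L2_loc)
  show "u \<in> H1_loc" using weak L2 by (auto simp: H1_loc_def)
  show "continuous_on UNIV u" by (rule contu)
  \<comment> \<open>This is the second derivative that \<open>P u = 0\<close> prescribes; the jump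
    of the coefficient makes it discontinuous at 1 in general.\<close>
  define w where "w = (\<lambda>x. - (of_real k)\<^sup>2 * (helmholtz_coeff y x * u x))"
  have dv: "(v has_vector_derivative w x) (at x)" if x: "0 < x" "x \<notin> {1}" for x
  proof (cases "x < 1")
    case True
    have "((\<lambda>x. A * \<kappa> * cos (\<kappa> * of_real x)) has_vector_derivative
         - \<kappa>\<^sup>2 * (A * sin (\<kappa> * of_real x))) (at x)"
      by (auto intro!: derivative_eq_intros has_vector_derivative_real_field simp: power2_eq_square)
    moreover have "- \<kappa>\<^sup>2 * (A * sin (\<kappa> * of_real x)) = w x"
      using True x by (simp add: w_def u_def kappa helmholtz_coeff_le_1)
    ultimately show ?thesis
      by (auto intro: has_vector_derivative_transform_within_open[where S = "{..<1}"]
          simp: True v_def)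
  next
    case False
    have "((\<lambda>x. \<i> * of_real k * exp (\<i> * of_real k * of_real x)) has_vector_derivative
         - (of_real k)\<^sup>2 * exp (\<i> * of_real k * of_real x)) (at x)"
      by (auto intro!: derivative_eq_intros has_vector_derivative_real_field
          simp: power2_eq_square algebra_simps)
    moreover have "- (of_real k)\<^sup>2 * exp (\<i> * of_real k * of_real x) = w x"
      using False x by (simp add: w_def u_def helmholtz_coeff_gt_1)
    ultimately show ?thesis
      using False x
      by (auto intro: has_vector_derivative_transform_within_open[where S = "{1<..}"]
          simp: v_def)
  qed
  \<comment> \<open>Continuity cannot be invoked for \<open>w\<close>, so the cut-off part is
    integrated as \<open>u\<close> over \<open>{max a 0..min b 1}\<close>.\<close>
  have intw: "set_integrable lebesgue {a..b} w" for a b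
  proof -
    have iu: "set_integrable lebesgue {a..b} u" for a b
      by (intro absolutely_integrable_continuous_real contu)
    have "set_integrable lebesgue {a..b} (\<lambda>x. indicator {0..1} x *\<^sub>R u x)"
      using iu[of "max a 0" "min b 1"]
      by (simp add: set_integrable_def flip: Int_atLeastAtMost indicator_inter_arith)
    from set_integral_diff(1)[OF iu[of a b] set_integrable_mult_right[OF this, of "1/2 + y"]]
    have "set_integrable lebesgue {a..b} (\<lambda>x. - (of_real k)\<^sup>2 *
        (u x - (1/2 + y) * (indicator {0..1} x *\<^sub>R u x)))"
      by (intro set_integrable_mult_right) auto
    also have "(\<lambda>x. - (of_real k)\<^sup>2 * (u x - (1/2 + y) * (indicator {0..1} x *\<^sub>R u x))) = w"
      by (auto simp: fun_eq_iff w_def helmholtz_coeff_def indicator_def algebra_simps)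
    finally show ?thesis .
  qed
  have "(LINT x:{0<..}|lebesgue. - (1 / (of_real k)\<^sup>2) * v x * vector_derivative \<phi> (at x)
        + helmholtz_coeff y x * u x * \<phi> x) = 0" if phi: "\<phi> \<in> test_functions" for \<phi>
  proof -
    have "continuous_on {0<..} v" using contv by (rule continuous_on_subset) auto
    note ibp = integration_by_parts_test_function[OF phi _ this dv intw, of "{1}", simplified]
    \<comment> \<open>By the choice of \<open>w\<close>, the integrand is a constant multiple of
      \<open>v \<phi>' + w \<phi>\<close>, the derivative of \<open>v \<phi>\<close> off 1.\<close>
    have "(LINT x:{0<..}|lebesgue. - (1 / (of_real k)\<^sup>2) * v x * vector_derivative \<phi> (at x)
        + helmholtz_coeff y x * u x * \<phi> x)
      = (LINT x:{0<..}|lebesgue. - (1 / (of_real k)\<^sup>2) * (v x * vector_derivative \<phi> (at x) + w x * \<phi> x))"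
      using \<open>0 < k\<close> by (intro arg_cong[where f = "set_lebesgue_integral _ _"])
        (auto simp: fun_eq_iff w_def field_simps)
    also have "\<dots> = - (1 / (of_real k)\<^sup>2) *
        (LINT x:{0<..}|lebesgue. v x * vector_derivative \<phi> (at x) + w x * \<phi> x)"
      by (rule set_integral_mult_right)
    also have "(LINT x:{0<..}|lebesgue. v x * vector_derivative \<phi> (at x) + w x * \<phi> x) = 0"
      using ibp by (subst set_integral_add(2)) auto
    finally show ?thesis by simp
  qed
  thus "helmholtz_weak_solution k y u"
    unfolding helmholtz_weak_solution_def using weak L2 by blast
qed

section \<open>Solving the matching condition\<close>

lemma inverse_sqrt_2_bounds: "7/10 < 1 / sqrt 2" "1 / sqrt 2 < 71/100"
proof -
  have "141/100 < sqrt 2" by (rule real_less_rsqrt) (simp add: power2_eq_square)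
  moreover have "sqrt 2 < 142/100" by (rule real_less_lsqrt) (simp_all add: power2_eq_square)
  ultimately show "7/10 < 1 / sqrt 2" "1 / sqrt 2 < 71/100" by (auto simp: field_simps)
qed

text \<open>If \<open>t = tanh \<tau>\<close>, the quotient is \<open>exp (2 * \<tau>)\<close>. At
  \<open>t = 1 / sqrt 2\<close> it equals \<open>3 + 2 * sqrt 2\<close>, about 5.83, and the bounds
  4 and 8 leave room for the perturbation. Avoiding the branch cut makes \<open>Ln\<close> of the
  quotient continuous.\<close>

lemma moebius_bounds:
  fixes t :: complex
  assumes "cmod (t - 1 / sqrt 2) \<le> 1/20"
  shows "1 - t \<noteq> 0" "4 \<le> cmod ((1 + t) / (1 - t))" "cmod ((1 + t) / (1 - t)) \<le> 8"
    "(1 + t) / (1 - t) \<notin> \<real>\<^sub>\<le>\<^sub>0"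
proof -
  define c where "c = 1 / sqrt 2"
  have c: "7/10 < c" "c < 71/100" using inverse_sqrt_2_bounds by (simp_all add: c_def)
  have tc: "cmod (t - of_real c) \<le> 1/20" using assms by (simp add: c_def)
  have p: "cmod (1 + of_real c) = 1 + c" "cmod (1 - of_real c) = 1 - c"
    using c norm_of_real[of "1 + c", where 'a = complex] norm_of_real[of "1 - c", where 'a = complex]
    by auto
  have b: "cmod (1 + t) \<ge> 1 + c - 1/20" "cmod (1 + t) \<le> 1 + c + 1/20"
    "cmod (1 - t) \<ge> 1 - c - 1/20" "cmod (1 - t) \<le> 1 - c + 1/20"
    using norm_triangle_ineq3[of "1 + t" "1 + of_real c"]
      norm_triangle_ineq3[of "1 - t" "1 - of_real c"] tc p
    by (auto simp: norm_minus_commute)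
  have pos: "cmod (1 - t) > 0" using b c by linarith
  thus t1: "1 - t \<noteq> 0" by auto
  show "4 \<le> cmod ((1 + t) / (1 - t))" "cmod ((1 + t) / (1 - t)) \<le> 8"
    using pos b c by (simp_all add: norm_divide field_simps)
  \<comment> \<open>A value \<open>r \<le> 0\<close> of the quotient would force
    \<open>cmod t * \<bar>1 + r\<bar> = 1 - r\<close>, impossible for \<open>cmod t < 1\<close>
    because \<open>\<bar>1 + r\<bar> \<le> 1 - r\<close>.\<close>
  have "cmod t < 1"
    using norm_triangle_ineq2[of t "of_real c"] tc c by auto
  show "(1 + t) / (1 - t) \<notin> \<real>\<^sub>\<le>\<^sub>0"
  proof
    assume "(1 + t) / (1 - t) \<in> \<real>\<^sub>\<le>\<^sub>0"
    then obtain r :: real where r: "r \<le> 0" "(1 + t) / (1 - t) = of_real r"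
      by (auto elim: nonpos_Reals_cases)
    hence "t * of_real (1 + r) = of_real (r - 1)"
      using t1 by (simp add: field_simps)
    hence "cmod t * \<bar>1 + r\<bar> = 1 - r"
      using r(1) by (metis norm_mult norm_of_real abs_minus_commute abs_of_nonneg
          diff_ge_0_iff_ge order_trans zero_le_one)
    moreover have "cmod t * \<bar>1 + r\<bar> \<le> cmod t * (1 - r)"
      using r(1) by (intro mult_left_mono) auto
    moreover have "cmod t * (1 - r) < 1 * (1 - r)"
      using r(1) \<open>cmod t < 1\<close> by (intro mult_strict_right_mono) auto
    ultimately show False by simp
  qed
qed

text \<open>\<open>tanh \<tau> = t\<close> follows from the fixed point equation \<open>\<tau> = Ln ((1 + t) / (1 - t)) / 2\<close>, whose
  right-hand side maps the disc of radius 4 to itself.\<close>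

lemma matching_condition_solvable:
  fixes k :: real
  assumes k: "80 \<le> k"
  obtains \<tau> :: complex where "1/2 \<le> cmod \<tau>" "cmod \<tau> \<le> 4" "sinh \<tau> \<noteq> 0"
    "(1 / sqrt 2 - \<i> * \<tau> / k) * cosh \<tau> = sinh \<tau>"
proof -
  define T where "T = (\<lambda>\<tau>::complex. 1 / sqrt 2 - \<i> * \<tau> / k)"
  define F where "F = (\<lambda>\<tau>. Ln ((1 + T \<tau>) / (1 - T \<tau>)) / 2)"
  \<comment> \<open>The bound is \<open>4 / k\<close> with \<open>k \<ge> 80\<close>.\<close>
  have T: "cmod (T \<tau> - 1 / sqrt 2) \<le> 1/20" if "\<tau> \<in> cball 0 4" for \<tau>
    using that k by (auto simp: T_def norm_divide norm_mult field_simps)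
  note mb = moebius_bounds[OF T]
  have "continuous_on (cball 0 4) T"
    unfolding T_def using k by (auto intro!: continuous_intros)
  hence "continuous_on (cball 0 4) F"
    unfolding F_def using mb by (intro continuous_intros) auto
  moreover have "F \<in> cball 0 4 \<rightarrow> cball 0 4"
  proof
    fix \<tau> :: complex assume tau: "\<tau> \<in> cball 0 4"
    define z where "z = (1 + T \<tau>) / (1 - T \<tau>)"
    have z: "4 \<le> cmod z" "cmod z \<le> 8" using mb[OF tau] by (simp_all add: z_def)
    hence "z \<noteq> 0" by auto
    \<comment> \<open>The real part of \<open>Ln z\<close> is at most 3 in modulus and the imaginary
      part at most 4, so half of \<open>Ln z\<close> stays in the disc of radius 4.\<close>
    have "ln (cmod z) \<le> ln 8" using z by (intro ln_mono) auto
    also have "ln 8 = 3 * ln (2::real)" using ln_realpow[of 2 3] by simp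
    also have "\<dots> \<le> 3" using ln_2_less_1 by simp
    finally have "\<bar>Re (Ln z)\<bar> \<le> 3" using z \<open>z \<noteq> 0\<close> by (simp add: ln_ge_zero)
    moreover have "\<bar>Im (Ln z)\<bar> \<le> 4"
      using mpi_less_Im_Ln[OF \<open>z \<noteq> 0\<close>] Im_Ln_le_pi[OF \<open>z \<noteq> 0\<close>] pi_less_4 by linarith
    ultimately have "cmod (Ln z) \<le> 8" using cmod_le[of "Ln z"] by linarith
    thus "F \<tau> \<in> cball 0 4" by (simp add: F_def z_def norm_divide)
  qed
  ultimately obtain \<tau> where tau: "\<tau> \<in> cball 0 4" "F \<tau> = \<tau>"
    by (rule brouwer_ball[of 4 0 F, rotated]) auto
  define z where "z = (1 + T \<tau>) / (1 - T \<tau>)"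
  have z: "4 \<le> cmod z" "1 - T \<tau> \<noteq> 0" using mb[OF tau(1)] by (simp_all add: z_def)
  hence "z \<noteq> 0" by auto
  have "2 * \<tau> = Ln z" using tau(2) by (simp add: F_def z_def)
  hence ez: "exp (2 * \<tau>) = z" using \<open>z \<noteq> 0\<close> by simp
  \<comment> \<open>From \<open>exp 1 \<le> 3\<close> and \<open>cmod z \<ge> 4\<close>; the
    resulting lower bound on \<open>\<tau>\<close> is what keeps \<open>k * cmod y\<close> away from
    0.\<close>
  have "exp 1 \<le> exp (Re (2 * \<tau>))"
    using z(1) exp_le norm_exp_eq_Re[of "2 * \<tau>"] unfolding ez by linarith
  hence "1/2 \<le> Re \<tau>" by simp
  hence n: "1/2 \<le> cmod \<tau>" using complex_Re_le_cmod[of \<tau>] by linarith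
  have e2: "exp \<tau> * exp \<tau> = z" using ez by (simp add: mult_exp_exp)
  \<comment> \<open>A zero of \<open>sinh\<close> would give \<open>exp (2 * \<tau>) = 1\<close>.
    Its exclusion later allows division by \<open>sin \<kappa>\<close>.\<close>
  have "exp \<tau> * exp \<tau> \<noteq> 1" using e2 z(1) by auto
  hence s0: "sinh \<tau> \<noteq> 0" by (auto simp: sinh_def exp_minus field_simps)
  have "z * (1 - T \<tau>) = 1 + T \<tau>" using z(2) by (simp add: z_def)
  hence "T \<tau> * (z + 1) = z - 1" by (simp add: algebra_simps)
  hence "T \<tau> * (exp \<tau> * exp \<tau> + 1) = exp \<tau> * exp \<tau> - 1" by (simp only: e2)
  hence "T \<tau> * cosh \<tau> = sinh \<tau>"
    by (simp add: sinh_def cosh_def exp_minus field_simps)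
  thus ?thesis using that n tau s0 by (auto simp: T_def)
qed

section \<open>Non-triviality and the choice of \<open>y\<close> and \<open>u\<close>\<close>

text \<open>Membership in \<open>H1_loc\<close> ignores null sets, so being non-zero is meant almost
  everywhere. The exponential has no zeros, and \<open>{2..3}\<close> has positive measure.\<close>

lemma not_AE_zero_if_plane_wave:
  assumes "\<And>x. 2 \<le> x \<Longrightarrow> u x = exp (\<i> * of_real k * of_real x)"
  shows "\<not> (AE x in lebesgue. 0 < x \<longrightarrow> u x = 0)"
proof
  assume "AE x in lebesgue. 0 < x \<longrightarrow> u x = 0"
  hence "AE x in lebesgue. x \<notin> {2..3::real}"
    by eventually_elim (use assms in auto)
  hence "emeasure lebesgue {2..3::real} = 0"
    by (subst (asm) AE_iff_measurable[of "{2..3}"]) auto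
  thus False by simp
qed

theorem theorem1p4:
  shows "\<exists>(m0::int) (C1::real) (C2::real). 0 < m0 \<and> 0 < C1 \<and> 0 < C2 \<and>
    (\<forall>(m::int) (k::real). m0 \<le> m \<longrightarrow> k = 2 * pi * of_int m * sqrt 2 \<longrightarrow>
      (\<exists>(y::complex) (u::real \<Rightarrow> complex).
         C1 \<le> k * cmod y \<and> k * cmod y \<le> C2 \<and>
         u \<in> H1_loc \<and>
         continuous_on {0..} u \<and>
         \<not> (AE x in lebesgue. 0 < x \<longrightarrow> u x = 0) \<and>
         helmholtz_weak_solution k y u \<and>
         u 0 = 0 \<and>
         (\<forall>x\<ge>2. u x = exp (\<i> * of_real k * of_real x))))"
\<comment> \<open>With \<open>m \<ge> 40\<close>, \<open>k \<ge> 240\<close> covers both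
  \<open>k \<ge> 80\<close> and \<open>16 / k \<le> 1/4\<close>. The leading term of
  \<open>k * y\<close> has modulus between 1/2 and 6 and the remainder at most 1/4, whence the
  constants 1/4 and 8.\<close>
proof (rule exI[of _ 40], rule exI[of _ "1/4"], rule exI[of _ 8], intro conjI allI impI)
  fix m :: int and k :: real
  assume m: "40 \<le> m" and k_def: "k = 2 * pi * of_int m * sqrt 2"
  have "2 * 3 * 40 * 1 \<le> k"
    unfolding k_def by (intro mult_mono) (use m pi_gt3 in auto)
  hence k: "240 \<le> k" by simp
  have "complex_of_real (sqrt 2) * complex_of_real (sqrt 2) = 2"
    by (metis of_real_mult of_real_numeral real_sqrt_mult_self abs_numeral)
  hence sq: "1 / complex_of_real (sqrt 2) = complex_of_real (sqrt 2) / 2"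
    "(complex_of_real (sqrt 2))\<^sup>2 = 2"
    by (auto simp: field_simps power2_eq_square)
  obtain \<tau> where tau: "1/2 \<le> cmod \<tau>" "cmod \<tau> \<le> 4" "sinh \<tau> \<noteq> 0"
    "(1 / sqrt 2 - \<i> * \<tau> / k) * cosh \<tau> = sinh \<tau>"
    using matching_condition_solvable[of k] k by auto
  define t where "t = 1 / sqrt 2 - \<i> * \<tau> / k"
  define \<kappa> where "\<kappa> = k * t"
  define y where "y = 1/2 - t\<^sup>2"
  \<comment> \<open>The special form of \<open>k\<close> enters here: the real shift is a whole
    number of periods and drops out of \<open>sin \<kappa>\<close> and
    \<open>cos \<kappa>\<close>.\<close>
  have kt: "\<kappa> = of_real (2 * pi * of_int m) - \<i> * \<tau>"
  proof -
    have "k / sqrt 2 = 2 * pi * of_int m" by (simp add: k_def)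
    hence "of_real k / of_real (sqrt 2) = (of_real (2 * pi * of_int m) :: complex)"
      by (metis of_real_divide)
    thus ?thesis using k by (simp add: \<kappa>_def t_def algebra_simps)
  qed
  have shift: "sin \<kappa> = - \<i> * sinh \<tau>" "cos \<kappa> = cosh \<tau>"
  proof -
    have "sin (complex_of_real (2 * pi * of_int m)) = 0" "cos (complex_of_real (2 * pi * of_int m)) = 1"
      by (simp_all only: sin_of_real cos_of_real sin_int_2pin cos_int_2pin of_real_0 of_real_1)
    thus "sin \<kappa> = - \<i> * sinh \<tau>" "cos \<kappa> = cosh \<tau>"
      by (simp_all only: kt sin_diff cos_diff sinh_conv_sin cosh_conv_cos) simp_all
  qed
  \<comment> \<open>Continuity at 1 determines the amplitude; the derivative condition then reduces
    to \<open>t * cos \<kappa> = \<i> * sin \<kappa>\<close>.\<close>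
  define A where "A = exp (\<i> * k) / sin \<kappa>"
  have s0: "sin \<kappa> \<noteq> 0" using shift tau by simp
  have "t * cos \<kappa> = \<i> * sin \<kappa>" using tau shift by (simp add: t_def)
  hence "A * \<kappa> * cos \<kappa> = \<i> * k * exp (\<i> * k)" 
    using s0 by (simp add: A_def \<kappa>_def field_simps)
  moreover have "A * sin \<kappa> = exp (\<i> * k)" using s0 by (simp add: A_def)
  moreover have "\<kappa>\<^sup>2 = k\<^sup>2 * (1/2 - y)" by (simp add: \<kappa>_def y_def power_mult_distrib)
  moreover define u where
    "u = (\<lambda>x. if x \<le> 1 then A * sin (\<kappa> * of_real x) else exp (\<i> * of_real k * of_real x))"
  ultimately have sol: "u \<in> H1_loc" "continuous_on UNIV u" "helmholtz_weak_solution k y u"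
    using outgoing_solution[of k A \<kappa> y] k by auto
  have u2: "u x = exp (\<i> * of_real k * of_real x)" if "2 \<le> x" for x
    using that by (simp add: u_def)
  have "of_real k * y = \<i> * of_real (sqrt 2) * \<tau> + \<tau>\<^sup>2 / k"
  proof -
    \<comment> \<open>The square of \<open>1 / sqrt 2\<close> cancels the \<open>1/2\<close>,
      leaving only terms that are small in \<open>1 / k\<close>.\<close>
    have "y = of_real (sqrt 2) * \<i> * \<tau> / k + \<tau>\<^sup>2 / k\<^sup>2"
      using sq(2) k unfolding y_def t_def of_real_divide of_real_1 sq(1)
      by (simp add: power2_diff power_divide power_mult_distrib)
    thus ?thesis using k by (simp add: field_simps power2_eq_square)
  qed
  hence ky: "k * cmod y = cmod (\<i> * of_real (sqrt 2) * \<tau> + \<tau>\<^sup>2 / k)"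
    using k by (metis norm_mult norm_of_real abs_of_nonneg order_trans zero_le_numeral)
  have small: "cmod (\<tau>\<^sup>2 / k) \<le> 1/4"
  proof -
    have "(cmod \<tau>)\<^sup>2 \<le> 4\<^sup>2" using tau by (intro power_mono) auto
    thus ?thesis using k by (simp add: norm_divide norm_power field_simps)
  qed
  have main: "1/2 \<le> cmod (\<i> * of_real (sqrt 2) * \<tau>)" "cmod (\<i> * of_real (sqrt 2) * \<tau>) \<le> 6"
  proof -
    have "sqrt 2 \<le> 3/2" by (rule real_le_lsqrt) (simp_all add: power2_eq_square)
    hence "sqrt 2 * cmod \<tau> \<le> (3/2) * 4" using tau by (intro mult_mono) auto
    moreover have "1 * (1/2) \<le> sqrt 2 * cmod \<tau>" using tau by (intro mult_mono) auto
    ultimately show "1/2 \<le> cmod (\<i> * of_real (sqrt 2) * \<tau>)" "cmod (\<i> * of_real (sqrt 2) * \<tau>) \<le> 6"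
      by (simp_all add: norm_mult)
  qed
  have "1/4 \<le> k * cmod y" "k * cmod y \<le> 8"
    using small main norm_triangle_ineq[of "\<i> * of_real (sqrt 2) * \<tau>" "\<tau>\<^sup>2 / k"]
      norm_diff_ineq[of "\<i> * of_real (sqrt 2) * \<tau>" "\<tau>\<^sup>2 / k"]
    unfolding ky by linarith+
  moreover have "continuous_on {0..} u" using sol(2) by (rule continuous_on_subset) auto
  moreover have "u 0 = 0" by (simp add: u_def)
  ultimately show "\<exists>y u. 1/4 \<le> k * cmod y \<and> k * cmod y \<le> 8 \<and> u \<in> H1_loc \<and>
      continuous_on {0..} u \<and> \<not> (AE x in lebesgue. 0 < x \<longrightarrow> u x = 0) \<and>
      helmholtz_weak_solution k y u \<and> u 0 = 0 \<and>
      (\<forall>x\<ge>2. u x = exp (\<i> * of_real k * of_real x))"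
    using sol u2 not_AE_zero_if_plane_wave[OF u2] by blast
qed auto

end
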